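(* Let $C$ be a diamond category and let $K$ be an object of $C$. The category $K$-$\mathrm{Ext}$ of $K$-extensions, whose objects are objects of $C$ together with an epimorphism to $K$ and whose morphisms are epimorphisms of $C$ respecting the epimorphisms to $K$, is a diamond category.
   Context: Let $C$ be a small category. A quotient of an object $G$ is a pair $(F,\pi)$ of an object $F$ and an epimorphism $\pi:G\to F$; quotients $(F,\pi),(F',\pi')$ are isomorphic if there is an isomorphism $\rho:F\to F'$ with $\pi'=\rho\pi$. Isomorphism classes of quotients of $G$ form a poset, where $H\ge F$ if there is $h:H\to F$ compatible with the morphisms from $G$; joins $\vee$ and meets $\wedge$ of quotients of $G$ are taken in this poset. A lattice (poset in which any two elements have a join and a meet) is modular if $a\le b$ implies $a\vee(x\wedge b)=(a\vee x)\wedge b$ for all $x$. For $F$ a quotient of $G$, $[F,G]$ is the poset of isomorphism classes of quotients of $G$ that are $\ge F$. An object is minimal if it has only one quotient (itself). A set $\mathcal{S}$ of objects, stable under isomorphism (equivalently a set of isomorphism classes), is downward-closed if every quotient of an object of $\mathcal{S}$ is in $\mathcal{S}$; it is join-closed if whenever $H,F\in\mathcal{S}$ are quotients of some object $G$ and $H\vee F$ exists, $H\vee F\in\mathcal{S}$. A level is a set of isomorphism classes generated by a finite set $B$ of isomorphism classes, i.e. the smallest downward-closed join-closed set containing $B$ and every minimal object. An epimorphism $G\to F$ is simple if it is not an isomorphism and $[F,G]$ contains only $F$ and $G$. A diamond category is a small category $C$ such that: (1) for each object $G$, the set of isomorphism classes of quotients of $G$ is a finite modular lattice; (2) each object has finite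 automorphism group; (3) for each level $\mathcal{L}$ and each $G\in\mathcal{L}$, there are finitely many elements of $\mathcal{L}$ with a simple epimorphism to $G$; (4) $C$ has at most countably many isomorphism classes of minimal objects. The paper never considers morphisms of $C$ that are not epimorphisms, and allows non-epimorphisms to be removed from $C$ for convenience. *)

theory Defs
  imports "HOL-Algebra.Lattice" "HOL-Library.Countable_Set"
begin

section \<open>Small categories\<close>

record ('o, 'm) cat =
  Obj :: "'o set"
  Arr :: "'m set"
  Dom :: "'m \<Rightarrow> 'o"
  Cod :: "'m \<Rightarrow> 'o"
  Ident :: "'o \<Rightarrow> 'm"
  Comp :: "'m \<Rightarrow> 'm \<Rightarrow> 'm"

text \<open>\<^term>\<open>Comp C g f\<close> is "g after f"; its value is only meaningful when
  \<^term>\<open>Cod C f = Dom C g\<close>.\<close>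

definition Hom :: "('o, 'm) cat \<Rightarrow> 'o \<Rightarrow> 'o \<Rightarrow> 'm set" where
  "Hom C A B = {f \<in> Arr C. Dom C f = A \<and> Cod C f = B}"

locale small_category =
  fixes C :: "('o, 'm) cat"
  assumes Dom_Obj: "f \<in> Arr C \<Longrightarrow> Dom C f \<in> Obj C"
    and Cod_Obj: "f \<in> Arr C \<Longrightarrow> Cod C f \<in> Obj C"
    and Ident_Hom: "A \<in> Obj C \<Longrightarrow> Ident C A \<in> Hom C A A"
    and Comp_Hom: "\<lbrakk>f \<in> Hom C A B; g \<in> Hom C B D\<rbrakk> \<Longrightarrow> Comp C g f \<in> Hom C A D"
    and Comp_Ident: "f \<in> Hom C A B \<Longrightarrow> Comp C f (Ident C A) = f"
    and Ident_Comp: "f \<in> Hom C A B \<Longrightarrow> Comp C (Ident C B) f = f"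
    and Comp_assoc: "\<lbrakk>f \<in> Hom C A B; g \<in> Hom C B D; h \<in> Hom C D E\<rbrakk>
      \<Longrightarrow> Comp C h (Comp C g f) = Comp C (Comp C h g) f"

definition epi :: "('o, 'm) cat \<Rightarrow> 'm \<Rightarrow> bool" where
  "epi C f \<longleftrightarrow> f \<in> Arr C \<and>
    (\<forall>B. \<forall>g \<in> Hom C (Cod C f) B. \<forall>h \<in> Hom C (Cod C f) B. Comp C g f = Comp C h f \<longrightarrow> g = h)"

definition iso :: "('o, 'm) cat \<Rightarrow> 'm \<Rightarrow> bool" where
  "iso C f \<longleftrightarrow> f \<in> Arr C \<and>
    (\<exists>g \<in> Hom C (Cod C f) (Dom C f).
      Comp C g f = Ident C (Dom C f) \<and> Comp C f g = Ident C (Cod C f))"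

definition Aut :: "('o, 'm) cat \<Rightarrow> 'o \<Rightarrow> 'm set" where
  "Aut C G = {f \<in> Hom C G G. iso C f}"

definition isomorphic :: "('o, 'm) cat \<Rightarrow> 'o \<Rightarrow> 'o \<Rightarrow> bool" where
  "isomorphic C A B \<longleftrightarrow> A \<in> Obj C \<and> B \<in> Obj C \<and> (\<exists>f \<in> Hom C A B. iso C f)"

definition iso_class :: "('o, 'm) cat \<Rightarrow> 'o \<Rightarrow> 'o set" where
  "iso_class C G = {H. isomorphic C G H}"

section \<open>Quotients\<close>

definition quotients :: "('o, 'm) cat \<Rightarrow> 'o \<Rightarrow> ('o \<times> 'm) set" where
  "quotients C G = {(F, p). F \<in> Obj C \<and> p \<in> Hom C G F \<and> epi C p}"

definition quot_iso :: "('o, 'm) cat \<Rightarrow> 'o \<Rightarrow> (('o \<times> 'm) \<times> ('o \<times> 'm)) set" where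
  "quot_iso C G = {((F, p), (F', p')). (F, p) \<in> quotients C G \<and> (F', p') \<in> quotients C G \<and>
    (\<exists>r \<in> Hom C F F'. iso C r \<and> p' = Comp C r p)}"

definition quot_class :: "('o, 'm) cat \<Rightarrow> 'o \<Rightarrow> 'o \<times> 'm \<Rightarrow> ('o \<times> 'm) set" where
  "quot_class C G Q = quot_iso C G `` {Q}"

definition quot_poset :: "('o, 'm) cat \<Rightarrow> 'o \<Rightarrow> ('o \<times> 'm) set gorder" where
  "quot_poset C G =
    \<lparr>carrier = quotients C G // quot_iso C G,
     eq = (=),
     le = (\<lambda>X Y. \<exists>(F, p) \<in> X. \<exists>(H, q) \<in> Y. \<exists>h \<in> Hom C H F. p = Comp C h q)\<rparr>"

definition quot_interval :: "('o, 'm) cat \<Rightarrow> 'o \<Rightarrow> 'o \<times> 'm \<Rightarrow> ('o \<times> 'm) set set" where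
  "quot_interval C G Q =
    {X \<in> carrier (quot_poset C G). quot_class C G Q \<sqsubseteq>\<^bsub>quot_poset C G\<^esub> X}"

definition minimal_object :: "('o, 'm) cat \<Rightarrow> 'o \<Rightarrow> bool" where
  "minimal_object C G \<longleftrightarrow> G \<in> Obj C \<and>
    carrier (quot_poset C G) = {quot_class C G (G, Ident C G)}"

definition simple_epi :: "('o, 'm) cat \<Rightarrow> 'm \<Rightarrow> bool" where
  "simple_epi C f \<longleftrightarrow> epi C f \<and> \<not> iso C f \<and>
    quot_interval C (Dom C f) (Cod C f, f) =
      {quot_class C (Dom C f) (Cod C f, f),
       quot_class C (Dom C f) (Dom C f, Ident C (Dom C f))}"

locale modular_lattice = lattice L for L (structure) +
  assumes modular: "\<lbrakk>a \<in> carrier L; b \<in> carrier L; x \<in> carrier L; a \<sqsubseteq> b\<rbrakk>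
    \<Longrightarrow> a \<squnion> (x \<sqinter> b) = (a \<squnion> x) \<sqinter> b"

section \<open>Levels\<close>

text \<open>A set of isomorphism classes is represented by its union, an isomorphism-stable set of
  objects.\<close>

definition iso_stable :: "('o, 'm) cat \<Rightarrow> 'o set \<Rightarrow> bool" where
  "iso_stable C S \<longleftrightarrow> S \<subseteq> Obj C \<and> (\<forall>G \<in> S. iso_class C G \<subseteq> S)"

definition downward_closed :: "('o, 'm) cat \<Rightarrow> 'o set \<Rightarrow> bool" where
  "downward_closed C S \<longleftrightarrow> (\<forall>G \<in> S. \<forall>(F, p) \<in> quotients C G. F \<in> S)"

text \<open>The hypothesis on \<open>least\<close> says that the join exists in the poset of quotients of \<open>G\<close>, which
  need not be a lattice here; \<open>(J, r)\<close> is any representative of it.\<close>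

definition join_closed :: "('o, 'm) cat \<Rightarrow> 'o set \<Rightarrow> bool" where
  "join_closed C S \<longleftrightarrow>
    (\<forall>G \<in> Obj C. \<forall>(H, p) \<in> quotients C G. \<forall>(F, q) \<in> quotients C G. \<forall>(J, r) \<in> quotients C G.
      H \<in> S \<longrightarrow> F \<in> S \<longrightarrow>
      least (quot_poset C G) (quot_class C G (J, r))
        (Upper (quot_poset C G) {quot_class C G (H, p), quot_class C G (F, q)}) \<longrightarrow> J \<in> S)"

definition level_generated :: "('o, 'm) cat \<Rightarrow> 'o set set \<Rightarrow> 'o set" where
  "level_generated C B = \<Inter> {S. iso_stable C S \<and> downward_closed C S \<and> join_closed C S \<and>
    \<Union> B \<subseteq> S \<and> {G. minimal_object C G} \<subseteq> S}"

definition is_level :: "('o, 'm) cat \<Rightarrow> 'o set \<Rightarrow> bool" where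
  "is_level C L \<longleftrightarrow> (\<exists>B. finite B \<and> B \<subseteq> iso_class C ` Obj C \<and> L = level_generated C B)"

section \<open>Diamond categories\<close>

locale diamond_category = small_category C for C :: "('o, 'm) cat" +
  assumes finite_quotients: "G \<in> Obj C \<Longrightarrow> finite (carrier (quot_poset C G))"
    and modular_quotients: "G \<in> Obj C \<Longrightarrow> modular_lattice (quot_poset C G)"
    and finite_Aut: "G \<in> Obj C \<Longrightarrow> finite (Aut C G)"
    and finite_simple: "\<lbrakk>is_level C L; G \<in> L\<rbrakk>
      \<Longrightarrow> finite {iso_class C H | H. H \<in> L \<and> (\<exists>f \<in> Hom C H G. simple_epi C f)}"
    and countable_minimal: "countable {iso_class C G | G. minimal_object C G}"

section \<open>The category of extensions of an object\<close>

definition Ext_obj :: "('o, 'm) cat \<Rightarrow> 'o \<Rightarrow> ('o \<times> 'm) set" where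
  "Ext_obj C K = {(G, p). G \<in> Obj C \<and> p \<in> Hom C G K \<and> epi C p}"

text \<open>A morphism of \<open>C\<close> may underlie several morphisms of extensions, so a morphism of extensions
  is the triple of its source, the underlying morphism of \<open>C\<close>, and its target.\<close>

definition Ext :: "('o, 'm) cat \<Rightarrow> 'o \<Rightarrow>
    ('o \<times> 'm, ('o \<times> 'm) \<times> 'm \<times> ('o \<times> 'm)) cat" where
  "Ext C K =
    \<lparr>Obj = Ext_obj C K,
     Arr = {((G, p), f, (H, q)) | G p f H q.
       (G, p) \<in> Ext_obj C K \<and> (H, q) \<in> Ext_obj C K \<and>
       f \<in> Hom C G H \<and> epi C f \<and> Comp C q f = p},
     Dom = (\<lambda>(X, f, Y). X),
     Cod = (\<lambda>(X, f, Y). Y),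
     Ident = (\<lambda>(G, p). ((G, p), Ident C G, (G, p))),
     Comp = (\<lambda>(Y', g, Z) (X, f, Y). (X, Comp C g f, Z))\<rparr>"

end

theory Submission
  imports Defs
begin

text \<open>A quotient of an extension \<open>(G, p)\<close> of \<open>K\<close> is a quotient \<open>(F, f)\<close> of \<open>G\<close> together with an
  epimorphism \<open>F \<rightarrow> K\<close> through which \<open>p\<close> factors. As \<open>f\<close> is an epimorphism, the map \<open>F \<rightarrow> K\<close> is
  unique if it exists, and it exists precisely when \<open>(F, f) \<ge> (K, p)\<close>. So the poset of quotients of
  \<open>(G, p)\<close> is the interval \<open>[(K, p), G]\<close>, a principal filter in the lattice of quotients of \<open>G\<close>
  (lemma \<open>quotients_filter\<close>). Such a filter inherits finiteness, joins, meets and modularity, and it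
  has the same intervals \<open>[F, G]\<close>, so a simple epimorphism of extensions is simple in \<open>C\<close>
  (lemma \<open>simple_epi_underlying\<close>).

  The finiteness of simple epimorphisms onto an extension within a level reduces to \<open>C\<close> in two
  steps. Forgetting the maps to \<open>K\<close> sends a level of extensions into a level of \<open>C\<close>, because joins
  in a principal filter are joins in the whole lattice (lemma \<open>level_underlying\<close>); hence the sources
  lie over finitely many isomorphism classes of \<open>C\<close>. Over each class there are only finitely many
  extensions, because an object \<open>H\<close> has finitely many epimorphisms to \<open>K\<close>: finitely many classes of
  quotients, each determining the epimorphism up to the finite group of automorphisms of \<open>K\<close> (lemma
  \<open>finite_epis\<close>).

  Automorphisms of an extension are automorphisms of its underlying object, and the only minimal
  extension up to isomorphism is \<open>K\<close> with its identity, since every extension has it as a quotient.\<close>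

section \<open>Principal filters of modular lattices\<close>

text \<open>The lattice-theoretic content, kept apart from categories: \<open>M\<close> is an abstract copy of the
  elements of \<open>L\<close> above \<open>k\<close>. All laws of \<open>M\<close>, those of a partial order included, are pulled back from
  \<open>L\<close>, since the lattice of quotients in \<open>C\<close> is what is known.\<close>

locale principal_filter_embedding = L: lattice L
  for L :: "'b gorder" and M :: "'a gorder" and k :: 'b and \<phi> :: "'a \<Rightarrow> 'b" +
  assumes k_closed: "k \<in> carrier L"
    and eq_M: "eq M = (=)"
    and inj: "inj_on \<phi> (carrier M)"
    and image: "\<phi> ` carrier M = {z \<in> carrier L. k \<sqsubseteq>\<^bsub>L\<^esub> z}"
    and le_iff: "\<lbrakk>a \<in> carrier M; b \<in> carrier M\<rbrakk> \<Longrightarrow> a \<sqsubseteq>\<^bsub>M\<^esub> b \<longleftrightarrow> \<phi> a \<sqsubseteq>\<^bsub>L\<^esub> \<phi> b"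
begin

lemma image_closed:
  assumes "a \<in> carrier M"
  shows "\<phi> a \<in> carrier L" and "k \<sqsubseteq>\<^bsub>L\<^esub> \<phi> a"
  using assms image by auto

lemma preimage:
  assumes "z \<in> carrier L" and "k \<sqsubseteq>\<^bsub>L\<^esub> z"
  obtains a where "a \<in> carrier M" and "\<phi> a = z"
  using assms image by (smt (verit) imageE mem_Collect_eq)

lemma above_image:
  assumes "a \<in> carrier M" and "z \<in> carrier L" and "\<phi> a \<sqsubseteq>\<^bsub>L\<^esub> z"
  shows "k \<sqsubseteq>\<^bsub>L\<^esub> z"
  using assms image_closed[of a] k_closed L.le_trans by blast

lemma partial_order_M: "partial_order M"
proof
  show "\<And>x y. \<lbrakk>x \<sqsubseteq>\<^bsub>M\<^esub> y; y \<sqsubseteq>\<^bsub>M\<^esub> x; x \<in> carrier M; y \<in> carrier M\<rbrakk> \<Longrightarrow> x .=\<^bsub>M\<^esub> y"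
    using image_closed inj L.le_antisym by (simp add: eq_M le_iff) (meson inj_onD)
  show "\<And>x y z. \<lbrakk>x \<sqsubseteq>\<^bsub>M\<^esub> y; y \<sqsubseteq>\<^bsub>M\<^esub> z; x \<in> carrier M; y \<in> carrier M; z \<in> carrier M\<rbrakk>
      \<Longrightarrow> x \<sqsubseteq>\<^bsub>M\<^esub> z"
    using image_closed L.le_trans by (simp add: le_iff)
qed (simp_all add: eq_M le_iff image_closed)

interpretation M: partial_order M
  by (rule partial_order_M)

text \<open>Every upper bound in \<open>L\<close> of two elements above \<open>k\<close> is itself above \<open>k\<close>, so the two posets have
  the same upper bounds, hence the same joins. The equivalence is also what turns join-closedness in
  \<open>C\<close> into join-closedness for extensions.\<close>

lemma least_Upper_iff:
  assumes "a \<in> carrier M" "b \<in> carrier M" "s \<in> carrier M"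
  shows "least M s (Upper M {a, b}) \<longleftrightarrow> least L (\<phi> s) (Upper L {\<phi> a, \<phi> b})"
proof
  assume s: "least M s (Upper M {a, b})"
  show "least L (\<phi> s) (Upper L {\<phi> a, \<phi> b})"
  proof (rule least_UpperI)
    fix z assume "z \<in> Upper L {\<phi> a, \<phi> b}"
    then have z: "z \<in> carrier L" "\<phi> a \<sqsubseteq>\<^bsub>L\<^esub> z" "\<phi> b \<sqsubseteq>\<^bsub>L\<^esub> z"
      using assms image_closed by (auto simp: Upper_def)
    then obtain c where "c \<in> carrier M" "\<phi> c = z"
      using above_image[OF assms(1)] preimage by metis
    then show "\<phi> s \<sqsubseteq>\<^bsub>L\<^esub> z"
      using z s assms by (auto simp: least_def Upper_def le_iff)
  qed (use s assms image_closed in \<open>auto simp: least_def Upper_def le_iff\<close>)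
qed (use assms image_closed in \<open>auto simp: least_def Upper_def le_iff\<close>)

text \<open>Only one implication is immediate for meets, because a lower bound in \<open>L\<close> of two elements above
  \<open>k\<close> need not be above \<open>k\<close>. It suffices, because the meet taken in \<open>L\<close> does lie above \<open>k\<close>.\<close>

lemma greatest_Lower_preimage:
  assumes "a \<in> carrier M" "b \<in> carrier M" "s \<in> carrier M"
    and "greatest L (\<phi> s) (Lower L {\<phi> a, \<phi> b})"
  shows "greatest M s (Lower M {a, b})"
  using assms image_closed by (auto simp: greatest_def Lower_def le_iff)

lemma join_preimage:
  assumes "a \<in> carrier M" "b \<in> carrier M"
  obtains s where "s \<in> carrier M" "\<phi> s = \<phi> a \<squnion>\<^bsub>L\<^esub> \<phi> b" "least M s (Upper M {a, b})"
proof -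
  have "k \<sqsubseteq>\<^bsub>L\<^esub> \<phi> a \<squnion>\<^bsub>L\<^esub> \<phi> b"
    using assms image_closed L.join_left above_image by simp
  then obtain s where s: "s \<in> carrier M" "\<phi> s = \<phi> a \<squnion>\<^bsub>L\<^esub> \<phi> b"
    using assms image_closed preimage by (metis L.join_closed)
  moreover have "least L (\<phi> a \<squnion>\<^bsub>L\<^esub> \<phi> b) (Upper L {\<phi> a, \<phi> b})"
    using L.sup_of_two_least assms image_closed by (simp add: join_def)
  ultimately show thesis
    using that assms least_Upper_iff by metis
qed

lemma meet_preimage:
  assumes "a \<in> carrier M" "b \<in> carrier M"
  obtains s where "s \<in> carrier M" "\<phi> s = \<phi> a \<sqinter>\<^bsub>L\<^esub> \<phi> b" "greatest M s (Lower M {a, b})"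
proof -
  have "k \<sqsubseteq>\<^bsub>L\<^esub> \<phi> a \<sqinter>\<^bsub>L\<^esub> \<phi> b"
    using assms image_closed k_closed L.meet_le by simp
  then obtain s where s: "s \<in> carrier M" "\<phi> s = \<phi> a \<sqinter>\<^bsub>L\<^esub> \<phi> b"
    using assms image_closed preimage by (metis L.meet_closed)
  moreover have "greatest L (\<phi> a \<sqinter>\<^bsub>L\<^esub> \<phi> b) (Lower L {\<phi> a, \<phi> b})"
    using L.inf_of_two_greatest assms image_closed by (simp add: meet_def)
  ultimately show thesis
    using that assms greatest_Lower_preimage by metis
qed

lemma lattice_M: "lattice M"
  by unfold_locales (metis join_preimage, metis meet_preimage)

interpretation M: lattice M
  by (rule lattice_M)

lemma image_join:
  assumes "a \<in> carrier M" "b \<in> carrier M"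
  shows "\<phi> (a \<squnion>\<^bsub>M\<^esub> b) = \<phi> a \<squnion>\<^bsub>L\<^esub> \<phi> b"
proof -
  obtain s where s: "\<phi> s = \<phi> a \<squnion>\<^bsub>L\<^esub> \<phi> b" "least M s (Upper M {a, b})"
    using join_preimage assms by metis
  moreover have "least M (a \<squnion>\<^bsub>M\<^esub> b) (Upper M {a, b})"
    using M.sup_of_two_least assms by (simp add: join_def)
  ultimately show ?thesis
    using M.least_unique by metis
qed

lemma image_meet:
  assumes "a \<in> carrier M" "b \<in> carrier M"
  shows "\<phi> (a \<sqinter>\<^bsub>M\<^esub> b) = \<phi> a \<sqinter>\<^bsub>L\<^esub> \<phi> b"
proof -
  obtain s where s: "\<phi> s = \<phi> a \<sqinter>\<^bsub>L\<^esub> \<phi> b" "greatest M s (Lower M {a, b})"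
    using meet_preimage assms by metis
  moreover have "greatest M (a \<sqinter>\<^bsub>M\<^esub> b) (Lower M {a, b})"
    using M.inf_of_two_greatest assms by (simp add: meet_def)
  ultimately show ?thesis
    using M.greatest_unique by metis
qed

lemma modular_lattice_M:
  assumes "modular_lattice L"
  shows "modular_lattice M"
proof
  interpret L: modular_lattice L by fact
  fix a b x
  assume ab: "a \<in> carrier M" "b \<in> carrier M" "x \<in> carrier M" "a \<sqsubseteq>\<^bsub>M\<^esub> b"
  have "\<phi> (a \<squnion>\<^bsub>M\<^esub> (x \<sqinter>\<^bsub>M\<^esub> b)) = \<phi> ((a \<squnion>\<^bsub>M\<^esub> x) \<sqinter>\<^bsub>M\<^esub> b)"
    using ab L.modular image_closed by (simp add: image_join image_meet le_iff)
  then show "a \<squnion>\<^bsub>M\<^esub> (x \<sqinter>\<^bsub>M\<^esub> b) = (a \<squnion>\<^bsub>M\<^esub> x) \<sqinter>\<^bsub>M\<^esub> b"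
    using inj ab by (simp add: inj_on_eq_iff)
qed

end

section \<open>Isomorphisms, quotients and levels in a category\<close>

text \<open>The order on representatives: \<open>Q\<close> is coarser than \<open>R\<close>, with no reference to classes.\<close>

definition quot_le :: "('o, 'm) cat \<Rightarrow> 'o \<times> 'm \<Rightarrow> 'o \<times> 'm \<Rightarrow> bool" where
  "quot_le C Q R \<longleftrightarrow> (\<exists>h \<in> Hom C (fst R) (fst Q). snd Q = Comp C h (snd R))"

text \<open>The definition with each quotient a single variable instead of a pair, which suits
  quotients given by projections.\<close>

lemma join_closed_iff:
  "join_closed C S \<longleftrightarrow>
    (\<forall>G \<in> Obj C. \<forall>Q \<in> quotients C G. \<forall>R \<in> quotients C G. \<forall>J \<in> quotients C G.
      fst Q \<in> S \<longrightarrow> fst R \<in> S \<longrightarrow>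
      least (quot_poset C G) (quot_class C G J)
        (Upper (quot_poset C G) {quot_class C G Q, quot_class C G R}) \<longrightarrow> fst J \<in> S)"
  by (simp add: join_closed_def case_prod_beta)

lemma join_closedD:
  assumes "join_closed C S" "G \<in> Obj C" "Q \<in> quotients C G" "R \<in> quotients C G" "J \<in> quotients C G"
    and "fst Q \<in> S" "fst R \<in> S"
    and "least (quot_poset C G) (quot_class C G J)
      (Upper (quot_poset C G) {quot_class C G Q, quot_class C G R})"
  shows "fst J \<in> S"
  using assms unfolding join_closed_iff by blast

lemma join_closed_Inter:
  assumes "\<And>S. S \<in> F \<Longrightarrow> join_closed C S"
  shows "join_closed C (\<Inter>F)"
  unfolding join_closed_iff
proof (intro ballI impI InterI)
  fix G Q R J S
  assume "G \<in> Obj C" "Q \<in> quotients C G" "R \<in> quotients C G" "J \<in> quotients C G"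
    and "fst Q \<in> \<Inter>F" "fst R \<in> \<Inter>F"
    and "least (quot_poset C G) (quot_class C G J)
      (Upper (quot_poset C G) {quot_class C G Q, quot_class C G R})"
    and "S \<in> F"
  then show "fst J \<in> S"
    using join_closedD[OF assms] by (meson InterD)
qed

context small_category
begin

lemma HomD:
  assumes "f \<in> Hom C A B"
  shows "f \<in> Arr C" "Dom C f = A" "Cod C f = B" "A \<in> Obj C" "B \<in> Obj C"
  using assms Dom_Obj Cod_Obj by (auto simp: Hom_def)

lemma epiI:
  assumes "f \<in> Hom C A B"
    and "\<And>D g h. \<lbrakk>g \<in> Hom C B D; h \<in> Hom C B D; Comp C g f = Comp C h f\<rbrakk> \<Longrightarrow> g = h"
  shows "epi C f"
  using assms HomD[OF assms(1)] by (auto simp: epi_def)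

lemma epi_cancel:
  assumes "epi C f" "f \<in> Hom C A B" "g \<in> Hom C B D" "h \<in> Hom C B D" "Comp C g f = Comp C h f"
  shows "g = h"
  using assms HomD(3)[OF assms(2)] by (auto simp: epi_def)

lemma epi_Ident:
  assumes "A \<in> Obj C"
  shows "epi C (Ident C A)"
  using assms by (intro epiI[OF Ident_Hom]) (auto simp: Comp_Ident)

lemma epi_Comp:
  assumes "f \<in> Hom C A B" "g \<in> Hom C B D" "epi C f" "epi C g"
  shows "epi C (Comp C g f)"
proof (rule epiI[OF Comp_Hom[OF assms(1,2)]])
  fix E x y
  assume x: "x \<in> Hom C D E" and y: "y \<in> Hom C D E"
    and eq: "Comp C x (Comp C g f) = Comp C y (Comp C g f)"
  have "Comp C (Comp C x g) f = Comp C (Comp C y g) f"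
    using eq Comp_assoc[OF assms(1,2) x] Comp_assoc[OF assms(1,2) y] by simp
  then have "Comp C x g = Comp C y g"
    using epi_cancel[OF assms(3,1)] Comp_Hom[OF assms(2)] x y by blast
  then show "x = y"
    using epi_cancel[OF assms(4,2)] x y by blast
qed

lemma epi_left_factor:
  assumes "f \<in> Hom C A B" "g \<in> Hom C B D" "epi C (Comp C g f)"
  shows "epi C g"
proof (rule epiI[OF assms(2)])
  fix E x y
  assume x: "x \<in> Hom C D E" and y: "y \<in> Hom C D E" and eq: "Comp C x g = Comp C y g"
  have "Comp C x (Comp C g f) = Comp C y (Comp C g f)"
    using eq Comp_assoc[OF assms(1,2) x] Comp_assoc[OF assms(1,2) y] by simp
  then show "x = y"
    using epi_cancel[OF assms(3) Comp_Hom[OF assms(1,2)]] x y by blast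
qed

lemma iso_iff:
  assumes "f \<in> Hom C A B"
  shows "iso C f \<longleftrightarrow>
    (\<exists>g \<in> Hom C B A. Comp C g f = Ident C A \<and> Comp C f g = Ident C B)"
  using HomD[OF assms] by (auto simp: iso_def)

lemma iso_epi:
  assumes "f \<in> Hom C A B" "iso C f"
  shows "epi C f"
proof -
  obtain g where g: "g \<in> Hom C B A" "Comp C f g = Ident C B"
    using assms iso_iff by blast
  then have "epi C (Comp C f g)"
    using epi_Ident HomD(5)[OF assms(1)] by simp
  with epi_left_factor[OF g(1) assms(1)] show ?thesis .
qed

lemma isomorphic_refl:
  assumes "A \<in> Obj C"
  shows "isomorphic C A A"
  using assms Ident_Hom[OF assms] Comp_Ident[OF Ident_Hom[OF assms]]
  unfolding isomorphic_def by (auto simp: iso_iff[OF Ident_Hom[OF assms]] intro!: bexI)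

lemma isomorphic_sym:
  assumes "isomorphic C A B"
  shows "isomorphic C B A"
proof -
  obtain f where f: "f \<in> Hom C A B" "iso C f"
    using assms unfolding isomorphic_def by blast
  then obtain g where g: "g \<in> Hom C B A" "Comp C g f = Ident C A" "Comp C f g = Ident C B"
    using iso_iff by blast
  then have "iso C g"
    using f(1) iso_iff[OF g(1)] by blast
  with g(1) assms show ?thesis
    unfolding isomorphic_def by blast
qed

lemma left_inverse_Comp:
  assumes f: "f \<in> Hom C A B" and g: "g \<in> Hom C B D"
    and g': "g' \<in> Hom C D B" and f': "f' \<in> Hom C B A"
    and "Comp C f' f = Ident C A" "Comp C g' g = Ident C B"
  shows "Comp C (Comp C f' g') (Comp C g f) = Ident C A"
proof -
  have "Comp C (Comp C f' g') (Comp C g f) = Comp C f' (Comp C g' (Comp C g f))"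
    using Comp_assoc[OF Comp_Hom[OF f g] g' f'] by simp
  also have "Comp C g' (Comp C g f) = f"
    using Comp_assoc[OF f g g'] Ident_Comp[OF f] assms by simp
  finally show ?thesis
    using assms by simp
qed

lemma isomorphic_trans:
  assumes "isomorphic C A B" "isomorphic C B D"
  shows "isomorphic C A D"
proof -
  obtain f where f: "f \<in> Hom C A B" "iso C f"
    using assms unfolding isomorphic_def by blast
  then obtain f' where f': "f' \<in> Hom C B A" "Comp C f' f = Ident C A" "Comp C f f' = Ident C B"
    using iso_iff by blast
  obtain g where g: "g \<in> Hom C B D" "iso C g"
    using assms unfolding isomorphic_def by blast
  then obtain g' where g': "g' \<in> Hom C D B" "Comp C g' g = Ident C B" "Comp C g g' = Ident C D"
    using iso_iff by blast
  have "Comp C (Comp C f' g') (Comp C g f) = Ident C A"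
    using left_inverse_Comp[OF f(1) g(1) g'(1) f'(1) f'(2) g'(2)] .
  moreover have "Comp C (Comp C g f) (Comp C f' g') = Ident C D"
    using left_inverse_Comp[OF g'(1) f'(1) f(1) g(1) g'(3) f'(3)] .
  ultimately have "iso C (Comp C g f)"
    using iso_iff[OF Comp_Hom[OF f(1) g(1)]] Comp_Hom[OF g'(1) f'(1)] by blast
  then show ?thesis
    using assms Comp_Hom[OF f(1) g(1)] unfolding isomorphic_def by blast
qed

lemma iso_class_eq:
  assumes "isomorphic C A B"
  shows "iso_class C A = iso_class C B"
  using assms isomorphic_sym isomorphic_trans unfolding iso_class_def by blast

lemma self_in_iso_class:
  assumes "A \<in> Obj C"
  shows "A \<in> iso_class C A"
  using assms isomorphic_refl by (simp add: iso_class_def)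

lemma mem_quotients: "Q \<in> quotients C G \<longleftrightarrow> snd Q \<in> Hom C G (fst Q) \<and> epi C (snd Q)"
  using HomD(5) by (auto simp: quotients_def)

lemma Ident_quotient: "G \<in> Obj C \<Longrightarrow> (G, Ident C G) \<in> quotients C G"
  by (simp add: mem_quotients Ident_Hom epi_Ident)

lemma quot_le_refl:
  assumes "Q \<in> quotients C G"
  shows "quot_le C Q Q"
  using assms HomD(5) Ident_Hom
  by (auto simp: mem_quotients quot_le_def Ident_Comp intro!: bexI[of _ "Ident C (fst Q)"])

lemma quot_le_trans:
  assumes "quot_le C Q R" "quot_le C R S" "S \<in> quotients C G"
  shows "quot_le C Q S"
proof -
  obtain h k where h: "h \<in> Hom C (fst R) (fst Q)" "snd Q = Comp C h (snd R)"
    and k: "k \<in> Hom C (fst S) (fst R)" "snd R = Comp C k (snd S)"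
    using assms by (auto simp: quot_le_def)
  then have "snd Q = Comp C (Comp C h k) (snd S)"
    using Comp_assoc[OF _ k(1) h(1), of "snd S" G] assms(3) by (simp add: mem_quotients)
  then show ?thesis
    using Comp_Hom[OF k(1) h(1)] unfolding quot_le_def by blast
qed

text \<open>Comparison morphisms in both directions are mutually inverse, because their composites agree with
  the identity after an epimorphism. So isomorphism of quotients is the equivalence induced by the
  preorder, and every later question about classes is settled by \<open>quot_le\<close> alone.\<close>

lemma quot_iso_iff:
  assumes "Q \<in> quotients C G" "R \<in> quotients C G"
  shows "(Q, R) \<in> quot_iso C G \<longleftrightarrow> quot_le C Q R \<and> quot_le C R Q"
proof
  assume "(Q, R) \<in> quot_iso C G"
  then obtain r where r: "r \<in> Hom C (fst Q) (fst R)" "iso C r" "snd R = Comp C r (snd Q)"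
    by (auto simp: quot_iso_def)
  then obtain s where s: "s \<in> Hom C (fst R) (fst Q)" "Comp C s r = Ident C (fst Q)"
    using iso_iff by blast
  have "Comp C s (snd R) = snd Q"
    using assms r s by (metis Comp_assoc Ident_Comp mem_quotients)
  with r s show "quot_le C Q R \<and> quot_le C R Q"
    unfolding quot_le_def by metis
next
  assume "quot_le C Q R \<and> quot_le C R Q"
  then obtain r s where r: "r \<in> Hom C (fst Q) (fst R)" "snd R = Comp C r (snd Q)"
    and s: "s \<in> Hom C (fst R) (fst Q)" "snd Q = Comp C s (snd R)"
    unfolding quot_le_def by metis
  have Q: "snd Q \<in> Hom C G (fst Q)" "epi C (snd Q)" and R: "snd R \<in> Hom C G (fst R)" "epi C (snd R)"
    using assms by (auto simp: mem_quotients)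
  have "Comp C (Comp C s r) (snd Q) = Comp C (Ident C (fst Q)) (snd Q)"
    using Q r s by (metis Comp_assoc Ident_Comp)
  then have sr: "Comp C s r = Ident C (fst Q)"
    using Q r s HomD(5) by (meson epi_cancel Comp_Hom Ident_Hom)
  have "Comp C (Comp C r s) (snd R) = Comp C (Ident C (fst R)) (snd R)"
    using R r s by (metis Comp_assoc Ident_Comp)
  then have "Comp C r s = Ident C (fst R)"
    using R r s HomD(5) by (meson epi_cancel Comp_Hom Ident_Hom)
  with sr r s have "iso C r"
    using iso_iff by blast
  with assms r show "(Q, R) \<in> quot_iso C G"
    by (auto simp: quot_iso_def case_prod_beta)
qed

lemma equiv_quot_iso: "equiv (quotients C G) (quot_iso C G)"
proof (rule equivI)
  have sub: "quot_iso C G \<subseteq> quotients C G \<times> quotients C G"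
    by (auto simp: quot_iso_def)
  then show "quot_iso C G \<subseteq> quotients C G \<times> quotients C G" .
  show "refl_on (quotients C G) (quot_iso C G)"
    using sub by (auto simp: refl_on_def quot_iso_iff quot_le_refl)
  show "sym (quot_iso C G)"
    using sub by (auto simp: sym_def) (metis mem_Sigma_iff quot_iso_iff subset_iff)
  show "trans (quot_iso C G)"
    using sub quot_le_trans
    by (intro transI) (metis (no_types, lifting) mem_Sigma_iff quot_iso_iff subset_iff)
qed

lemma carrier_quot_poset: "carrier (quot_poset C G) = quot_class C G ` quotients C G"
  by (auto simp: quot_poset_def quotient_def quot_class_def)

lemma eq_quot_poset: "eq (quot_poset C G) = (=)"
  by (simp add: quot_poset_def)

lemma quot_class_eq_iff:
  assumes "Q \<in> quotients C G" "R \<in> quotients C G"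
  shows "quot_class C G Q = quot_class C G R \<longleftrightarrow> quot_le C Q R \<and> quot_le C R Q"
  using assms eq_equiv_class_iff[OF equiv_quot_iso] by (simp add: quot_class_def quot_iso_iff)

lemma mem_quot_class:
  assumes "Q \<in> quotients C G"
  shows "R \<in> quot_class C G Q \<longleftrightarrow> R \<in> quotients C G \<and> quot_le C Q R \<and> quot_le C R Q"
proof -
  have "R \<in> quot_class C G Q \<Longrightarrow> R \<in> quotients C G"
    by (auto simp: quot_class_def quot_iso_def)
  then show ?thesis
    using quot_iso_iff[OF assms, of R] by (auto simp: quot_class_def)
qed

lemma le_quot_class_iff:
  assumes "Q \<in> quotients C G" "R \<in> quotients C G"
  shows "quot_class C G Q \<sqsubseteq>\<^bsub>quot_poset C G\<^esub> quot_class C G R \<longleftrightarrow> quot_le C Q R"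
proof -
  have "quot_class C G Q \<sqsubseteq>\<^bsub>quot_poset C G\<^esub> quot_class C G R \<longleftrightarrow>
      (\<exists>Q' \<in> quot_class C G Q. \<exists>R' \<in> quot_class C G R. quot_le C Q' R')"
    by (simp add: quot_poset_def quot_le_def case_prod_beta)
  also have "\<dots> \<longleftrightarrow> quot_le C Q R"
    using assms by (metis mem_quot_class quot_le_refl quot_le_trans)
  finally show ?thesis .
qed

text \<open>The intersection defining a level is over a nonempty family, as the set of all objects belongs to
  it; this is what keeps the level inside the set of objects.\<close>

lemma level_generated_closed:
  assumes "\<Union> B \<subseteq> Obj C"
  shows "iso_stable C (level_generated C B)" and "downward_closed C (level_generated C B)"
    and "join_closed C (level_generated C B)" and "\<Union> B \<subseteq> level_generated C B"
proof -
  let ?F = "{S. iso_stable C S \<and> downward_closed C S \<and> join_closed C S \<and> \<Union> B \<subseteq> S \<and>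
    {G. minimal_object C G} \<subseteq> S}"
  have "Obj C \<in> ?F"
    using assms
    by (auto simp: iso_stable_def downward_closed_def join_closed_def iso_class_def
        isomorphic_def quotients_def minimal_object_def)
  then have "\<Inter> ?F \<subseteq> Obj C"
    by blast
  then show "iso_stable C (level_generated C B)"
    unfolding level_generated_def iso_stable_def by blast
  show "downward_closed C (level_generated C B)"
    unfolding level_generated_def downward_closed_def by blast
  show "join_closed C (level_generated C B)"
    unfolding level_generated_def by (rule join_closed_Inter) simp
  show "\<Union> B \<subseteq> level_generated C B"
    unfolding level_generated_def by (rule Inter_greatest) simp
qed

end

text \<open>Epimorphisms from \<open>H\<close> to \<open>K\<close> in the same class of quotients of \<open>H\<close> differ by an automorphism of
  \<open>K\<close>, and both the classes and the automorphisms are finite in number.\<close>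

lemma (in diamond_category) finite_epis:
  assumes "H \<in> Obj C" "K \<in> Obj C"
  shows "finite {q \<in> Hom C H K. epi C q}" (is "finite ?E")
proof (rule finite_subset)
  let ?fib = "\<lambda>Z. {q \<in> ?E. quot_class C H (K, q) = Z}"
  show "?E \<subseteq> (\<Union>Z \<in> carrier (quot_poset C H). ?fib Z)"
    by (force simp: carrier_quot_poset mem_quotients)
  have "finite (?fib Z)" for Z
  proof (cases "\<exists>q0. q0 \<in> ?fib Z")
    case True
    then obtain q0 where q0: "q0 \<in> ?fib Z" by blast
    have "?fib Z \<subseteq> (\<lambda>r. Comp C r q0) ` Aut C K"
    proof
      fix q assume q: "q \<in> ?fib Z"
      then have "((K, q0), (K, q)) \<in> quot_iso C H"
        using q0 by (simp add: quot_iso_iff mem_quotients quot_class_eq_iff[symmetric, of _ H])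
      then show "q \<in> (\<lambda>r. Comp C r q0) ` Aut C K"
        by (auto simp: quot_iso_def Aut_def)
    qed
    then show ?thesis
      using finite_Aut[OF assms(2)] finite_subset by blast
  next
    case False
    then have "?fib Z = {}" by blast
    then show ?thesis by (metis finite.emptyI)
  qed
  then show "finite (\<Union>Z \<in> carrier (quot_poset C H). ?fib Z)"
    using finite_quotients[OF assms(1)] by blast
qed

section \<open>The category of extensions\<close>

locale extension_category = diamond_category C for C :: "('o, 'm) cat" +
  fixes K :: 'o
  assumes K_Obj: "K \<in> Obj C"
begin

abbreviation E where "E \<equiv> Ext C K"

text \<open>Extensions and their morphisms in terms of projections rather than tuple patterns. Here \<open>fst X\<close>
  is the underlying object of an extension and \<open>snd X\<close> its epimorphism to \<open>K\<close>.\<close>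

lemma Obj_E: "X \<in> Obj E \<longleftrightarrow> snd X \<in> Hom C (fst X) K \<and> epi C (snd X)"
  using HomD(4) by (auto simp: Ext_def Ext_obj_def)

lemma fst_Obj: "X \<in> Obj E \<Longrightarrow> fst X \<in> Obj C"
  using HomD(4) by (auto simp: Obj_E)

lemma Hom_E: "m \<in> Hom E X Y \<longleftrightarrow> (\<exists>f. m = (X, f, Y) \<and> X \<in> Obj E \<and> Y \<in> Obj E \<and>
    f \<in> Hom C (fst X) (fst Y) \<and> epi C f \<and> Comp C (snd Y) f = snd X)"
  by (cases X; cases Y) (auto simp: Hom_def Ext_def)

lemma Ident_E: "Ident E X = (X, Ident C (fst X), X)"
  by (simp add: Ext_def case_prod_beta)

lemma Comp_E: "Comp E (Y', g, Z) (X, f, Y) = (X, Comp C g f, Z)"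
  by (simp add: Ext_def)

lemma small_category_E: "small_category E"
proof
  show "Dom E f \<in> Obj E" "Cod E f \<in> Obj E" if "f \<in> Arr E" for f
    using that by (auto simp: Ext_def)
  show "Ident E A \<in> Hom E A A" if "A \<in> Obj E" for A
    using that fst_Obj[OF that]
    by (auto simp: Hom_E Ident_E Ident_Hom epi_Ident Obj_E Comp_Ident)
  show "Comp E g f \<in> Hom E A D" if "f \<in> Hom E A B" "g \<in> Hom E B D" for A B D f g
  proof -
    obtain u where u: "f = (A, u, B)" "u \<in> Hom C (fst A) (fst B)" "epi C u"
        "Comp C (snd B) u = snd A" "A \<in> Obj E" "B \<in> Obj E"
      using \<open>f \<in> Hom E A B\<close> unfolding Hom_E by blast
    obtain v where v: "g = (B, v, D)" "v \<in> Hom C (fst B) (fst D)" "epi C v"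
        "Comp C (snd D) v = snd B" "D \<in> Obj E"
      using \<open>g \<in> Hom E B D\<close> unfolding Hom_E by blast
    have "snd D \<in> Hom C (fst D) K"
      using v(5) by (simp add: Obj_E)
    then have "Comp C (snd D) (Comp C v u) = snd A"
      using Comp_assoc[OF u(2) v(2)] u(4) v(4) by simp
    then show ?thesis
      using u v Comp_Hom[OF u(2) v(2)] epi_Comp[OF u(2) v(2)] by (simp add: Hom_E Comp_E)
  qed
  show "Comp E f (Ident E A) = f" "Comp E (Ident E B) f = f" if "f \<in> Hom E A B" for A B f
    using that by (auto simp: Hom_E Comp_E Ident_E Comp_Ident Ident_Comp)
  show "Comp E h (Comp E g f) = Comp E (Comp E h g) f"
    if "f \<in> Hom E A B" "g \<in> Hom E B D" "h \<in> Hom E D F" for A B D F f g h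
    using that by (auto simp: Hom_E Comp_E intro: Comp_assoc)
qed

sublocale E: small_category E
  by (rule small_category_E)

text \<open>All morphisms of extensions are epimorphisms of \<open>C\<close>, and cancellation there gives
  cancellation here.\<close>

lemma epi_E:
  assumes "m \<in> Hom E X Y"
  shows "epi E m"
proof (rule E.epiI[OF assms])
  fix Z g h
  assume "g \<in> Hom E Y Z" "h \<in> Hom E Y Z" "Comp E g m = Comp E h m"
  with assms show "g = h"
    using epi_cancel by (fastforce simp: Hom_E Comp_E)
qed

text \<open>The inverse in \<open>C\<close> of a morphism over \<open>K\<close> is again over \<open>K\<close>.\<close>

lemma iso_E:
  assumes "(X, f, Y) \<in> Hom E X Y"
  shows "iso E (X, f, Y) \<longleftrightarrow> iso C f"
proof
  have f: "f \<in> Hom C (fst X) (fst Y)" "X \<in> Obj E" "Y \<in> Obj E" "Comp C (snd Y) f = snd X"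
    using assms by (auto simp: Hom_E)
  show "iso C f" if "iso E (X, f, Y)"
    using that E.iso_iff[OF assms] iso_iff[OF f(1)] by (auto simp: Hom_E Comp_E Ident_E)
  show "iso E (X, f, Y)" if iso: "iso C f"
  proof -
    obtain g where g: "g \<in> Hom C (fst Y) (fst X)" "Comp C g f = Ident C (fst X)"
        "Comp C f g = Ident C (fst Y)"
      using iso iso_iff[OF f(1)] by blast
    then have "epi C g"
      using f(1) iso_epi iso_iff by blast
    moreover have "Comp C (snd X) g = snd Y"
    proof -
      have Y: "snd Y \<in> Hom C (fst Y) K"
        using f(3) by (simp add: Obj_E)
      have "Comp C (Comp C (snd Y) f) g = Comp C (snd Y) (Comp C f g)"
        using Comp_assoc[OF g(1) f(1) Y] by simp
      then show ?thesis
        using f(4) g(3) Comp_Ident[OF Y] by simp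
    qed
    ultimately have "(Y, g, X) \<in> Hom E Y X"
      using f g by (simp add: Hom_E)
    with g show ?thesis
      unfolding E.iso_iff[OF assms] by (auto simp: Comp_E Ident_E intro!: bexI)
  qed
qed

lemma isomorphic_underlying:
  assumes "isomorphic E X Y"
  shows "isomorphic C (fst X) (fst Y)"
proof -
  obtain m where m: "m \<in> Hom E X Y" "iso E m" and XY: "X \<in> Obj E" "Y \<in> Obj E"
    using assms unfolding isomorphic_def by blast
  then obtain f where f: "m = (X, f, Y)" "f \<in> Hom C (fst X) (fst Y)"
    unfolding Hom_E by blast
  have "iso C f"
    using iso_E[of X f Y] m by (simp add: f(1))
  with f(2) XY[THEN fst_Obj] show ?thesis
    unfolding isomorphic_def by blast
qed

text \<open>The quotient \<open>(F, f)\<close> of \<open>G\<close> given by a quotient of an extension with underlying object \<open>G\<close>: it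
  forgets the map \<open>F \<rightarrow> K\<close> and the source and target tags of the morphism.\<close>

definition underlying :: "('o \<times> 'm) \<times> ('o \<times> 'm) \<times> 'm \<times> ('o \<times> 'm) \<Rightarrow> 'o \<times> 'm" where
  "underlying Q = (fst (fst Q), fst (snd (snd Q)))"

lemma mem_quotients_E: "Q \<in> quotients E X \<longleftrightarrow> snd Q \<in> Hom E X (fst Q)"
  using epi_E unfolding E.mem_quotients by blast

lemma underlying_quotient:
  assumes "Q \<in> quotients E X"
  shows "underlying Q \<in> quotients C (fst X)"
  using assms by (auto simp: mem_quotients_E Hom_E mem_quotients underlying_def)

text \<open>A comparison morphism found in \<open>C\<close> automatically respects the maps to \<open>K\<close>: the two maps to \<open>K\<close>
  that have to agree do so after precomposing with an epimorphism.\<close>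

lemma quot_le_underlying:
  assumes "Q \<in> quotients E X" "R \<in> quotients E X"
  shows "quot_le E Q R \<longleftrightarrow> quot_le C (underlying Q) (underlying R)"
proof -
  obtain f where f: "snd Q = (X, f, fst Q)" "f \<in> Hom C (fst X) (fst (fst Q))" "epi C f"
      "Comp C (snd (fst Q)) f = snd X" "fst Q \<in> Obj E"
    using assms by (auto simp: mem_quotients_E Hom_E)
  obtain g where g: "snd R = (X, g, fst R)" "g \<in> Hom C (fst X) (fst (fst R))" "epi C g"
      "Comp C (snd (fst R)) g = snd X" "fst R \<in> Obj E"
    using assms by (auto simp: mem_quotients_E Hom_E)
  have QK: "snd (fst Q) \<in> Hom C (fst (fst Q)) K" and RK: "snd (fst R) \<in> Hom C (fst (fst R)) K"
    using f(5) g(5) by (simp_all add: Obj_E)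
  have lift: "(fst R, h, fst Q) \<in> Hom E (fst R) (fst Q)"
    if h: "h \<in> Hom C (fst (fst R)) (fst (fst Q))" "f = Comp C h g" for h
  proof -
    have "epi C h"
      using epi_left_factor[OF g(2) h(1)] f h by simp
    moreover have "Comp C (Comp C (snd (fst Q)) h) g = Comp C (snd (fst R)) g"
      using Comp_assoc[OF g(2) h(1) QK] h(2) f(4) g(4) by simp
    then have "Comp C (snd (fst Q)) h = snd (fst R)"
      using epi_cancel[OF g(3,2) Comp_Hom[OF h(1) QK] RK] by simp
    ultimately show ?thesis
      using f g h by (simp add: Hom_E)
  qed
  have "quot_le E Q R \<longleftrightarrow> (\<exists>h \<in> Hom C (fst (fst R)) (fst (fst Q)). f = Comp C h g)"
  proof
    assume "quot_le E Q R"
    then obtain m where m: "m \<in> Hom E (fst R) (fst Q)" "snd Q = Comp E m (snd R)"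
      unfolding quot_le_def by blast
    then obtain h where "m = (fst R, h, fst Q)" "h \<in> Hom C (fst (fst R)) (fst (fst Q))"
      unfolding Hom_E by blast
    with m(2) show "\<exists>h \<in> Hom C (fst (fst R)) (fst (fst Q)). f = Comp C h g"
      by (auto simp: f(1) g(1) Comp_E)
  next
    assume "\<exists>h \<in> Hom C (fst (fst R)) (fst (fst Q)). f = Comp C h g"
    then obtain h where h: "h \<in> Hom C (fst (fst R)) (fst (fst Q))" "f = Comp C h g"
      by blast
    have "snd Q = Comp E (fst R, h, fst Q) (snd R)"
      by (simp add: f(1) g(1) Comp_E h(2))
    with lift[OF h] show "quot_le E Q R"
      unfolding quot_le_def by blast
  qed
  then show ?thesis
    by (simp add: quot_le_def underlying_def f(1) g(1))
qed

text \<open>A comparison of \<open>Q\<close> with the base quotient \<open>(K, snd X)\<close> is exactly a structure map to \<open>K\<close>; it is an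
  epimorphism because it is the last factor of one.\<close>

lemma lift_quotient:
  assumes "X \<in> Obj E" "Q \<in> quotients C (fst X)" "quot_le C (K, snd X) Q"
  obtains R where "R \<in> quotients E X" "underlying R = Q"
proof -
  obtain h where h: "h \<in> Hom C (fst Q) K" "snd X = Comp C h (snd Q)"
    using assms by (auto simp: quot_le_def)
  have Q: "snd Q \<in> Hom C (fst X) (fst Q)"
    using assms(2) by (simp add: mem_quotients)
  have "epi C h"
    using epi_left_factor[OF Q h(1)] assms(1) h(2) by (simp add: Obj_E)
  with assms h have "((fst Q, h), X, snd Q, (fst Q, h)) \<in> quotients E X"
    by (auto simp: mem_quotients_E Hom_E Obj_E mem_quotients)
  then show thesis
    using that[of "((fst Q, h), X, snd Q, (fst Q, h))"] by (simp add: underlying_def)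
qed

lemma base_le_underlying:
  assumes "Q \<in> quotients E X"
  shows "quot_le C (K, snd X) (underlying Q)"
  using assms by (auto simp: mem_quotients_E Hom_E quot_le_def underlying_def Obj_E intro!: bexI)

lemma base_quotient:
  assumes "X \<in> Obj E"
  shows "(K, snd X) \<in> quotients C (fst X)"
  using assms by (auto simp: mem_quotients Obj_E)

text \<open>Forgetting the structure maps sends a class onto a whole class and not just into one: anything
  isomorphic to a quotient above the base is above the base, hence lifts. This makes the image
  operation a map between the two posets.\<close>

lemma underlying_image_quot_class:
  assumes "Q \<in> quotients E X"
  shows "underlying ` quot_class E X Q = quot_class C (fst X) (underlying Q)"
proof (intro subset_antisym subsetI)
  have X: "X \<in> Obj E"
    using assms by (auto simp: mem_quotients_E Hom_E)
  fix P
  show "P \<in> quot_class C (fst X) (underlying Q)" if "P \<in> underlying ` quot_class E X Q"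
    using that assms
    by (auto simp: E.mem_quot_class mem_quot_class underlying_quotient quot_le_underlying)
  assume P: "P \<in> quot_class C (fst X) (underlying Q)"
  then have P': "P \<in> quotients C (fst X)" "quot_le C (underlying Q) P" "quot_le C P (underlying Q)"
    using assms mem_quot_class underlying_quotient by blast+
  then have "quot_le C (K, snd X) P"
    using base_le_underlying[OF assms] quot_le_trans by blast
  then obtain R where "R \<in> quotients E X" "underlying R = P"
    using lift_quotient X P' by metis
  then show "P \<in> underlying ` quot_class E X Q"
    using P' assms by (auto simp: E.mem_quot_class quot_le_underlying)
qed

text \<open>Comparison is the same before and after forgetting the structure
  maps, and the quotients that lift are those above the base quotient, which is the structure map of
  the extension regarded as a quotient of its underlying object.\<close>

lemma quotients_filter:
  assumes X: "X \<in> Obj E"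
  shows "principal_filter_embedding (quot_poset C (fst X)) (quot_poset E X)
    (quot_class C (fst X) (K, snd X)) (image underlying)"
    (is "principal_filter_embedding ?L ?M ?k ?\<phi>")
proof -
  interpret L: modular_lattice ?L
    using modular_quotients fst_Obj X by blast
  show ?thesis
  proof
    show "?k \<in> carrier ?L"
      using X base_quotient by (simp add: carrier_quot_poset)
    show "eq ?M = (=)"
      by (rule E.eq_quot_poset)
    show "inj_on ?\<phi> (carrier ?M)"
    proof (rule inj_onI)
      fix a b assume "a \<in> carrier ?M" "b \<in> carrier ?M" and eq: "?\<phi> a = ?\<phi> b"
      then obtain Q R where "a = quot_class E X Q" "b = quot_class E X R"
          "Q \<in> quotients E X" "R \<in> quotients E X"
        by (auto simp: E.carrier_quot_poset)
      with eq show "a = b"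
        by (simp add: underlying_image_quot_class quot_class_eq_iff E.quot_class_eq_iff
            underlying_quotient quot_le_underlying)
    qed
    show "?\<phi> ` carrier ?M = {z \<in> carrier ?L. ?k \<sqsubseteq>\<^bsub>?L\<^esub> z}"
    proof (intro subset_antisym subsetI)
      fix z assume "z \<in> ?\<phi> ` carrier ?M"
      then show "z \<in> {z \<in> carrier ?L. ?k \<sqsubseteq>\<^bsub>?L\<^esub> z}"
        using X by (auto simp: E.carrier_quot_poset carrier_quot_poset underlying_image_quot_class
            underlying_quotient le_quot_class_iff base_quotient base_le_underlying)
    next
      fix z assume "z \<in> {z \<in> carrier ?L. ?k \<sqsubseteq>\<^bsub>?L\<^esub> z}"
      then obtain Q where Q: "Q \<in> quotients C (fst X)" "z = quot_class C (fst X) Q"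
          "quot_le C (K, snd X) Q"
        using X by (auto simp: carrier_quot_poset le_quot_class_iff base_quotient)
      then obtain R where R: "R \<in> quotients E X" "underlying R = Q"
        using lift_quotient X by metis
      then have "z = ?\<phi> (quot_class E X R)"
        using Q underlying_image_quot_class[OF R(1)] by simp
      with R show "z \<in> ?\<phi> ` carrier ?M"
        by (auto simp: E.carrier_quot_poset)
    qed
    show "a \<sqsubseteq>\<^bsub>?M\<^esub> b \<longleftrightarrow> ?\<phi> a \<sqsubseteq>\<^bsub>?L\<^esub> ?\<phi> b" if "a \<in> carrier ?M" "b \<in> carrier ?M" for a b
      using that by (auto simp: E.carrier_quot_poset underlying_image_quot_class
          le_quot_class_iff E.le_quot_class_iff underlying_quotient quot_le_underlying)
  qed
qed

text \<open>Simplicity is a statement about the quotients above a given one. When that one is above the base,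
  so are all of these, and the interval is the same in both categories.\<close>

lemma simple_epi_underlying:
  assumes m: "(Y, f, X) \<in> Hom E Y X" and simple: "simple_epi E (Y, f, X)"
  shows "f \<in> Hom C (fst Y) (fst X)" and "simple_epi C f"
proof -
  have f: "f \<in> Hom C (fst Y) (fst X)" "epi C f" and Y: "Y \<in> Obj E"
    using m by (auto simp: Hom_E)
  show "f \<in> Hom C (fst Y) (fst X)" by fact
  interpret F: principal_filter_embedding "quot_poset C (fst Y)" "quot_poset E Y"
    "quot_class C (fst Y) (K, snd Y)" "image underlying"
    using quotients_filter Y by blast
  let ?Q = "(X, Y, f, X)"
  have Q: "?Q \<in> quotients E Y" and I: "(Y, Ident E Y) \<in> quotients E Y"
    using m Y by (simp_all add: mem_quotients_E E.Ident_Hom)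
  have uQ: "underlying ?Q = (fst X, f)" and uI: "underlying (Y, Ident E Y) = (fst Y, Ident C (fst Y))"
    by (simp_all add: underlying_def Ident_E)
  have Q_closed: "quot_class E Y ?Q \<in> carrier (quot_poset E Y)"
    using Q by (simp add: E.carrier_quot_poset)
  have "quot_interval C (fst Y) (underlying ?Q) = image underlying ` quot_interval E Y ?Q"
  proof (intro subset_antisym subsetI)
    fix z assume "z \<in> quot_interval C (fst Y) (underlying ?Q)"
    then have z: "z \<in> carrier (quot_poset C (fst Y))"
        "underlying ` quot_class E Y ?Q \<sqsubseteq>\<^bsub>quot_poset C (fst Y)\<^esub> z"
      by (simp_all add: quot_interval_def underlying_image_quot_class[OF Q])
    then obtain a where "a \<in> carrier (quot_poset E Y)" "underlying ` a = z"
      using F.above_image[OF Q_closed] F.preimage by metis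
    with z show "z \<in> image underlying ` quot_interval E Y ?Q"
      using Q_closed by (auto simp: quot_interval_def F.le_iff)
  next
    fix z assume "z \<in> image underlying ` quot_interval E Y ?Q"
    then show "z \<in> quot_interval C (fst Y) (underlying ?Q)"
      using Q_closed F.image_closed
      by (auto simp: quot_interval_def F.le_iff simp flip: underlying_image_quot_class[OF Q])
  qed
  also have "quot_interval E Y ?Q = {quot_class E Y ?Q, quot_class E Y (Y, Ident E Y)}"
    using simple E.HomD[OF m] by (simp add: simple_epi_def)
  finally have "quot_interval C (fst Y) (fst X, f) =
      {quot_class C (fst Y) (fst X, f), quot_class C (fst Y) (fst Y, Ident C (fst Y))}"
    using underlying_image_quot_class[OF Q] underlying_image_quot_class[OF I] uQ uI by simp
  moreover have "\<not> iso C f"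
    using simple iso_E[OF m] by (simp add: simple_epi_def)
  ultimately show "simple_epi C f"
    using f HomD[OF f(1)] by (simp add: simple_epi_def)
qed

text \<open>An extension whose underlying object is isomorphic to \<open>H\<close> can be transported along the
  isomorphism to one on \<open>H\<close> itself, and \<open>H\<close> carries finitely many.\<close>

lemma finite_extensions:
  assumes "A \<in> iso_class C ` Obj C"
  shows "finite {iso_class E Y | Y. Y \<in> Obj E \<and> fst Y \<in> A}"
proof -
  obtain H where H: "H \<in> Obj C" "A = iso_class C H"
    using assms by blast
  have "iso_class E Y \<in> (\<lambda>q. iso_class E (H, q)) ` {q \<in> Hom C H K. epi C q}"
    if Y: "Y \<in> Obj E" "fst Y \<in> A" for Y
  proof -
    obtain f where f: "f \<in> Hom C H (fst Y)" "iso C f"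
      using Y H by (auto simp: iso_class_def isomorphic_def)
    let ?q = "Comp C (snd Y) f"
    have q: "?q \<in> Hom C H K" "epi C ?q"
      using Y f by (auto simp: Obj_E intro: Comp_Hom epi_Comp iso_epi)
    then have "((H, ?q), f, Y) \<in> Hom E (H, ?q) Y"
      using Y f iso_epi by (auto simp: Hom_E Obj_E)
    then have "isomorphic E (H, ?q) Y"
      using f iso_E E.HomD unfolding isomorphic_def by blast
    then show ?thesis
      using q E.iso_class_eq by blast
  qed
  then have "{iso_class E Y | Y. Y \<in> Obj E \<and> fst Y \<in> A}
      \<subseteq> (\<lambda>q. iso_class E (H, q)) ` {q \<in> Hom C H K. epi C q}"
    by blast
  then show ?thesis
    using finite_epis[OF H(1) K_Obj] finite_subset by blast
qed

lemma base_Obj: "(K, Ident C K) \<in> Obj E"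
  using K_Obj by (simp add: Obj_E Ident_Hom epi_Ident)

text \<open>The structure map makes \<open>K\<close> with its identity a quotient of every extension; if there is only one
  quotient, this one is isomorphic to the extension.\<close>

lemma minimal_object_E:
  assumes "minimal_object E X"
  shows "isomorphic E X (K, Ident C K)"
proof -
  have X: "X \<in> Obj E"
    using assms by (simp add: minimal_object_def)
  let ?Q = "((K, Ident C K), X, snd X, (K, Ident C K))"
  have Q: "?Q \<in> quotients E X"
    using X base_Obj by (auto simp: mem_quotients_E Hom_E Obj_E Ident_Comp)
  then have "quot_class E X (X, Ident E X) = quot_class E X ?Q"
    using assms by (auto simp: minimal_object_def E.carrier_quot_poset)
  then have "((X, Ident E X), ?Q) \<in> quot_iso E X"
    using Q E.Ident_quotient[OF X] by (simp add: E.quot_class_eq_iff E.quot_iso_iff)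
  then show ?thesis
    using X base_Obj by (auto simp: quot_iso_def isomorphic_def)
qed

text \<open>The level of \<open>C\<close> is generated by the underlying objects of the generators together with \<open>K\<close>. The
  object \<open>K\<close> is added because it underlies the minimal extensions, which belong to every level of
  extensions, while \<open>K\<close> need not be minimal in \<open>C\<close>. The extensions with underlying object in this
  level satisfy all the closure conditions, hence contain the given level.\<close>

lemma level_underlying:
  assumes "is_level E L"
  obtains L' where "is_level C L'" "L \<subseteq> Obj E" "fst ` L \<subseteq> L'"
proof -
  obtain B where B: "finite B" "B \<subseteq> iso_class E ` Obj E" "L = level_generated E B"
    using assms by (auto simp: is_level_def)
  then obtain T where T: "finite T" "T \<subseteq> Obj E" "B = iso_class E ` T"
    using finite_subset_image by metis
  define B' where "B' = iso_class C ` insert K (fst ` T)"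
  define L' where "L' = level_generated C B'"
  have "\<Union> B' \<subseteq> Obj C"
    by (auto simp: B'_def iso_class_def isomorphic_def)
  note L' = level_generated_closed[OF this, folded L'_def]
  define S where "S = {Y \<in> Obj E. fst Y \<in> L'}"
  have stable: "iso_class C (fst Y) \<subseteq> L'" if "fst Y \<in> L'" for Y :: "'o \<times> 'm"
    using that L'(1) by (simp add: iso_stable_def)
  have class_S: "Z \<in> S" if "isomorphic E Y Z" "iso_class C (fst Y) \<subseteq> L'" for Y Z
    using that isomorphic_underlying[OF that(1)]
    by (auto simp: S_def iso_class_def isomorphic_def)
  have "iso_stable E S"
    using class_S stable by (auto simp: iso_stable_def iso_class_def) (auto simp: S_def)
  moreover have "downward_closed E S"
    unfolding downward_closed_def
  proof (intro ballI, clarify)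
    fix Y F p assume Y: "Y \<in> S" and Q: "(F, p) \<in> quotients E Y"
    then have "fst F \<in> L'"
      using underlying_quotient[OF Q] L'(2)
      by (fastforce simp: downward_closed_def S_def underlying_def)
    then show "F \<in> S"
      using Q by (simp add: S_def quotients_def)
  qed
  moreover have "join_closed E S"
    unfolding join_closed_iff
  proof (intro ballI impI)
    fix X P Q J
    assume X: "X \<in> Obj E" and PQJ: "P \<in> quotients E X" "Q \<in> quotients E X" "J \<in> quotients E X"
      and S: "fst P \<in> S" "fst Q \<in> S"
      and least: "least (quot_poset E X) (quot_class E X J)
        (Upper (quot_poset E X) {quot_class E X P, quot_class E X Q})"
    interpret F: principal_filter_embedding "quot_poset C (fst X)" "quot_poset E X"
      "quot_class C (fst X) (K, snd X)" "image underlying"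
      using quotients_filter X by blast
    have "least (quot_poset C (fst X)) (quot_class C (fst X) (underlying J))
        (Upper (quot_poset C (fst X)) {quot_class C (fst X) (underlying P),
          quot_class C (fst X) (underlying Q)})"
      using least PQJ
      by (simp add: E.carrier_quot_poset F.least_Upper_iff flip: underlying_image_quot_class)
    moreover have "fst (underlying P) \<in> L'" "fst (underlying Q) \<in> L'"
      using S by (simp_all add: S_def underlying_def)
    ultimately have "fst (underlying J) \<in> L'"
      using L'(3) fst_Obj[OF X] PQJ[THEN underlying_quotient] unfolding join_closed_iff by blast
    moreover have "fst J \<in> Obj E"
      using PQJ(3) E.HomD(5) E.mem_quotients by blast
    ultimately show "fst J \<in> S"
      by (simp add: S_def underlying_def)
  qed
  moreover have "Z \<in> S" if "Y \<in> T" "Z \<in> iso_class E Y" for Y Z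
  proof (rule class_S)
    show "isomorphic E Y Z"
      using that(2) by (simp add: iso_class_def)
    show "iso_class C (fst Y) \<subseteq> L'"
      using L'(4) that(1) by (auto simp: B'_def)
  qed
  then have "\<Union> B \<subseteq> S"
    by (auto simp: T(3))
  moreover have "X \<in> S" if "minimal_object E X" for X
  proof (rule class_S)
    show "isomorphic E (K, Ident C K) X"
      using E.isomorphic_sym[OF minimal_object_E[OF that]] .
    show "iso_class C (fst (K, Ident C K)) \<subseteq> L'"
      using L'(4) by (simp add: B'_def)
  qed
  then have "{X. minimal_object E X} \<subseteq> S"
    by blast
  ultimately have "L \<subseteq> S"
    unfolding B(3) level_generated_def by (intro Inter_lower) simp
  moreover have "insert K (fst ` T) \<subseteq> Obj C"
    using T(2) fst_Obj K_Obj by blast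
  then have "B' \<subseteq> iso_class C ` Obj C"
    unfolding B'_def by (rule image_mono)
  then have "is_level C L'"
    using T(1) unfolding is_level_def L'_def by (intro exI[of _ B']) (simp add: B'_def)
  ultimately show thesis
    using that by (auto simp: S_def)
qed

lemma diamond_category_E: "diamond_category E"
proof (intro diamond_category.intro diamond_category_axioms.intro)
  show "small_category E"
    by (rule small_category_E)
next
  fix X assume X: "X \<in> Obj E"
  interpret F: principal_filter_embedding "quot_poset C (fst X)" "quot_poset E X"
    "quot_class C (fst X) (K, snd X)" "image underlying"
    using quotients_filter X by blast
  have "finite (image underlying ` carrier (quot_poset E X))"
    using finite_quotients[OF fst_Obj[OF X]] by (simp add: F.image)
  then show "finite (carrier (quot_poset E X))"
    using F.inj finite_imageD by blast
  show "modular_lattice (quot_poset E X)"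
    using F.modular_lattice_M modular_quotients fst_Obj X by blast
  have "Aut E X \<subseteq> (\<lambda>f. (X, f, X)) ` Aut C (fst X)"
    using iso_E by (fastforce simp: Aut_def Hom_E)
  then show "finite (Aut E X)"
    using finite_Aut[OF fst_Obj[OF X]] finite_subset by blast
next
  fix L X assume L: "is_level E L" and X: "X \<in> L"
  obtain L' where L': "is_level C L'" "L \<subseteq> Obj E" "fst ` L \<subseteq> L'"
    using level_underlying L by blast
  \<comment> \<open>The classes in \<open>C\<close> over which the sources of simple epimorphisms onto \<open>X\<close> can lie.\<close>
  define \<A> where
    "\<A> = {iso_class C H | H. H \<in> L' \<and> (\<exists>f \<in> Hom C H (fst X). simple_epi C f)}"
  have A: "finite \<A>" "\<A> \<subseteq> iso_class C ` Obj C"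
    using finite_simple[OF L'(1), of "fst X"] L'(3) X HomD(4) by (auto simp: \<A>_def)
  have "\<exists>A \<in> \<A>. fst Y \<in> A" if Y: "Y \<in> L" "m \<in> Hom E Y X" "simple_epi E m" for Y m
  proof
    obtain f where "m = (Y, f, X)"
      using Y by (auto simp: Hom_E)
    then have "f \<in> Hom C (fst Y) (fst X)" "simple_epi C f"
      using simple_epi_underlying Y by blast+
    then show "iso_class C (fst Y) \<in> \<A>"
      using Y L'(3) by (auto simp: \<A>_def)
    show "fst Y \<in> iso_class C (fst Y)"
      using Y L'(2) fst_Obj self_in_iso_class by blast
  qed
  then have "{iso_class E Y | Y. Y \<in> L \<and> (\<exists>m \<in> Hom E Y X. simple_epi E m)}
      \<subseteq> (\<Union>A \<in> \<A>. {iso_class E Y | Y. Y \<in> Obj E \<and> fst Y \<in> A})"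
    using L'(2) by (smt (verit) UN_I mem_Collect_eq subset_iff)
  moreover have "finite (\<Union>A \<in> \<A>. {iso_class E Y | Y. Y \<in> Obj E \<and> fst Y \<in> A})"
    using A finite_extensions by blast
  ultimately show "finite {iso_class E Y | Y. Y \<in> L \<and> (\<exists>m \<in> Hom E Y X. simple_epi E m)}"
    using finite_subset by blast
next
  have "{iso_class E X | X. minimal_object E X} \<subseteq> {iso_class E (K, Ident C K)}"
    using minimal_object_E E.iso_class_eq by blast
  then show "countable {iso_class E X | X. minimal_object E X}"
    by (rule countable_subset) simp
qed

end

theorem lemma6p21:
  fixes C :: "('o, 'm) cat" and K :: 'o
  assumes "diamond_category C"
    and "K \<in> Obj C"
  shows "diamond_category (Ext C K)"
proof -
  interpret extension_category C K
    using assms by (simp add: extension_category_def extension_category_axioms_def)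
  show ?thesis
    by (rule diamond_category_E)
qed

end
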